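(* Consider the $N$-state, state-matching problem with Shannon information costs described in the context. 1. For any payments/biases $\tau:\mathcal A\to\mathbb R_+$ and corresponding $\pi:\Omega\to\Delta(\mathcal A)$ that solves the agent's problem with payments $\tau$ and prior $\mu_p$, there exists a prior belief $\mu\in\Delta(\Omega)$ such that $\pi$ also solves the agent's problem without payments and with prior $\mu$. 2. For any $\mu\in\Delta(\Omega)$ and the corresponding $\pi_\mu:\Omega\to\Delta(\mathcal A)$ that solves the agent's problem without payments and with prior $\mu$, there exist payments $\tau:\mathcal A\to\mathbb R_+$ such that $\pi_\mu$ also solves the agent's problem with payments $\tau$ and prior $\mu_p$. As a consequence, the principal's problem of contracting on actions with $\rho=0$ and agent's prior $\mu_p$ is equivalent to her delegation problem of choosing the agent's prior: the same set of decision rules $\pi$ is implementable in both problems, and the objective is the same.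
   Context: $N>2$; states $\Omega=\{\omega_1,\dots,\omega_N\}$, actions $\mathcal A=\{a_1,\dots,a_N\}$, payoffs $u(a_i,\omega_i)=1$, $u(a_i,\omega_j)=0$ for $i\neq j$; $\mu_p\in\Delta(\Omega)$ is the principal's prior. Agent's problem with payments $\tau$ and prior $\mu$: choose $\pi:\Omega\to\Delta(\mathcal A)$ to maximize $$\sum_j\mu(\omega_j)\sum_i\pi(a_i|\omega_j)\big(u(a_i,\omega_j)+\tau(a_i)\big)-\lambda\sum_{j}\sum_{i}\mu(\omega_j)\pi(a_i|\omega_j)\ln\frac{\pi(a_i|\omega_j)}{\beta(a_i)},\qquad \beta(a_i)=\sum_j\mu(\omega_j)\pi(a_i|\omega_j),$$ with $\lambda>0$, $0\ln0=0$. "Without payments" means $\tau\equiv0$. Solutions are taken to satisfy, for all $i,j$ (automatically if $\mu(\omega_j)>0$, by convention if $\mu(\omega_j)=0$), $$\pi(a_i|\omega_j)=\frac{\beta(a_i)e^{(u(a_i,\omega_j)+\tau(a_i))/\lambda}}{\sum_k\beta(a_k)e^{(u(a_k,\omega_j)+\tau(a_k))/\lambda}} .$$ Contracting problem: the principal chooses $\tau:\mathcal A\to\mathbb R_+$ to maximize $\sum_j\mu_p(\omega_j)\sum_i\pi(a_i|\omega_j)(u(a_i,\omega_j)-\rho\tau(a_i))$ where $\pi$ solves the agent's problem with payments $\tau$ and the agent's prior, $\rho\ge0$ being the principal's marginal utility of money. Delegation problem: the principal chooses $\mu\in\Delta(\Omega)$ to maximize $\sum_j\mu_p(\omega_j)\sum_i\pi(a_i|\omega_j)u(a_i,\omega_j)$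 where $\pi$ solves the agent's problem without payments and with prior $\mu$. *)

theory Defs
  imports "HOL-Probability.Probability_Mass_Function"
begin

text \<open>
  A finite type \<open>'n\<close> with \<open>N\<close> elements indexes both the states and the actions: \<open>i :: 'n\<close> stands
  for the action \<open>a\<^sub>i\<close> as well as for the state \<open>\<omega>\<^sub>i\<close>. Beliefs are of type \<open>'n pmf\<close>. A decision rule
  \<open>\<pi>\<close> is of type \<open>'n \<Rightarrow> 'n pmf\<close>, and \<open>pmf (\<pi> j) i\<close> is \<open>\<pi>(a\<^sub>i | \<omega>\<^sub>j)\<close>.
\<close>

definition match_payoff :: "'n \<Rightarrow> 'n \<Rightarrow> real" where
  "match_payoff i j = (if i = j then 1 else 0)"

definition action_prob :: "('n::finite) pmf \<Rightarrow> ('n \<Rightarrow> 'n pmf) \<Rightarrow> 'n \<Rightarrow> real" where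
  "action_prob \<mu> \<pi> i = (\<Sum>j\<in>UNIV. pmf \<mu> j * pmf (\<pi> j) i)"

text \<open>
  The convention \<open>0 ln 0 = 0\<close> needs no case distinction below: if \<open>pmf \<mu> j * pmf (\<pi> j) i > 0\<close>
  then \<open>action_prob \<mu> \<pi> i > 0\<close>, and otherwise the summand is \<open>0\<close> whatever the logarithm is.
\<close>

definition agent_objective ::
    "real \<Rightarrow> ('n \<Rightarrow> real) \<Rightarrow> ('n::finite) pmf \<Rightarrow> ('n \<Rightarrow> 'n pmf) \<Rightarrow> real" where
  "agent_objective lam \<tau> \<mu> \<pi> =
     (\<Sum>j\<in>UNIV. pmf \<mu> j * (\<Sum>i\<in>UNIV. pmf (\<pi> j) i * (match_payoff i j + \<tau> i)))
     - lam * (\<Sum>j\<in>UNIV. \<Sum>i\<in>UNIV.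
         pmf \<mu> j * pmf (\<pi> j) i * ln (pmf (\<pi> j) i / action_prob \<mu> \<pi> i))"

definition logit_at ::
    "real \<Rightarrow> ('n \<Rightarrow> real) \<Rightarrow> ('n::finite) pmf \<Rightarrow> ('n \<Rightarrow> 'n pmf) \<Rightarrow> 'n \<Rightarrow> bool" where
  "logit_at lam \<tau> \<mu> \<pi> j \<longleftrightarrow>
     (\<forall>i. pmf (\<pi> j) i =
        action_prob \<mu> \<pi> i * exp ((match_payoff i j + \<tau> i) / lam)
        / (\<Sum>k\<in>UNIV. action_prob \<mu> \<pi> k * exp ((match_payoff k j + \<tau> k) / lam)))"

text \<open>
  The objective does not constrain \<open>\<pi>\<close> at states of prior probability \<open>0\<close>; there the logit formula
  is imposed as a convention. At states of positive probability it holds for every maximizer, see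
  \<open>agent_maximizer_logit_at\<close> below.
\<close>

definition solves_agent ::
    "real \<Rightarrow> ('n \<Rightarrow> real) \<Rightarrow> ('n::finite) pmf \<Rightarrow> ('n \<Rightarrow> 'n pmf) \<Rightarrow> bool" where
  "solves_agent lam \<tau> \<mu> \<pi> \<longleftrightarrow>
     is_arg_max (agent_objective lam \<tau> \<mu>) (\<lambda>_. True) \<pi> \<and> (\<forall>j. logit_at lam \<tau> \<mu> \<pi> j)"

definition contracting_feasible ::
    "real \<Rightarrow> ('n::finite) pmf \<Rightarrow> (('n \<Rightarrow> real) \<times> ('n \<Rightarrow> 'n pmf)) set" where
  "contracting_feasible lam \<mu>\<^sub>a = {(\<tau>, \<pi>). (\<forall>i. 0 \<le> \<tau> i) \<and> solves_agent lam \<tau> \<mu>\<^sub>a \<pi>}"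

definition contracting_objective ::
    "real \<Rightarrow> ('n::finite) pmf \<Rightarrow> ('n \<Rightarrow> real) \<Rightarrow> ('n \<Rightarrow> 'n pmf) \<Rightarrow> real" where
  "contracting_objective \<rho> \<mu>\<^sub>p \<tau> \<pi> =
     (\<Sum>j\<in>UNIV. pmf \<mu>\<^sub>p j * (\<Sum>i\<in>UNIV. pmf (\<pi> j) i * (match_payoff i j - \<rho> * \<tau> i)))"

definition delegation_feasible ::
    "real \<Rightarrow> (('n::finite) pmf \<times> ('n \<Rightarrow> 'n pmf)) set" where
  "delegation_feasible lam = {(\<mu>, \<pi>). solves_agent lam (\<lambda>_. 0) \<mu> \<pi>}"

definition delegation_objective :: "('n::finite) pmf \<Rightarrow> ('n \<Rightarrow> 'n pmf) \<Rightarrow> real" where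
  "delegation_objective \<mu>\<^sub>p \<pi> =
     (\<Sum>j\<in>UNIV. pmf \<mu>\<^sub>p j * (\<Sum>i\<in>UNIV. pmf (\<pi> j) i * match_payoff i j))"

text \<open>
  Should the agent's problem have several solutions, the principal selects among them. The
  principal's prior \<open>\<mu>\<^sub>p\<close> and the agent's prior \<open>\<mu>\<^sub>a\<close> are separate parameters.
\<close>

definition solves_contracting ::
    "real \<Rightarrow> real \<Rightarrow> ('n::finite) pmf \<Rightarrow> 'n pmf \<Rightarrow> ('n \<Rightarrow> real) \<Rightarrow> ('n \<Rightarrow> 'n pmf) \<Rightarrow> bool" where
  "solves_contracting lam \<rho> \<mu>\<^sub>p \<mu>\<^sub>a \<tau> \<pi> \<longleftrightarrow>
     is_arg_max (\<lambda>(\<tau>, \<pi>). contracting_objective \<rho> \<mu>\<^sub>p \<tau> \<pi>)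
       (\<lambda>x. x \<in> contracting_feasible lam \<mu>\<^sub>a) (\<tau>, \<pi>)"

definition solves_delegation ::
    "real \<Rightarrow> ('n::finite) pmf \<Rightarrow> 'n pmf \<Rightarrow> ('n \<Rightarrow> 'n pmf) \<Rightarrow> bool" where
  "solves_delegation lam \<mu>\<^sub>p \<mu> \<pi> \<longleftrightarrow>
     is_arg_max (\<lambda>(\<mu>, \<pi>). delegation_objective \<mu>\<^sub>p \<pi>)
       (\<lambda>x. x \<in> delegation_feasible lam) (\<mu>, \<pi>)"

lemma gibbs_term:
  fixes p q :: real
  assumes "0 \<le> p" "0 \<le> q" "0 < p \<Longrightarrow> 0 < q"
  shows "p - q \<le> p * ln (p / q)" and "p * ln (p / q) = p - q \<Longrightarrow> p = q"
proof -
  have "p - q \<le> p * ln (p / q) \<and> (p * ln (p / q) = p - q \<longrightarrow> p = q)"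
  proof (cases "p = 0")
    case False
    with assms have pq: "0 < p" "0 < q" by auto
    have ln: "ln (p / q) = - ln (q / p)"
      using pq by (simp add: ln_div)
    have "ln (q / p) \<le> q / p - 1"
      using pq by (intro ln_le_minus_one) simp
    hence "p * ln (q / p) \<le> p * (q / p - 1)"
      using pq by (intro mult_left_mono) auto
    also have r: "p * (q / p - 1) = q - p"
      using pq by (simp add: field_simps)
    finally have 1: "p - q \<le> p * ln (p / q)"
      unfolding ln by simp
    have 2: "p = q" if "p * ln (p / q) = p - q"
    proof -
      have "p * ln (q / p) = p * (q / p - 1)"
        using that r unfolding ln by simp
      hence "ln (q / p) = q / p - 1"
        using pq by simp
      with pq have "q / p = 1"
        by (intro ln_eq_minus_one) auto
      with pq show ?thesis by simp
    qed
    from 1 2 show ?thesis by blast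
  qed (use assms in auto)
  thus "p - q \<le> p * ln (p / q)" and "p * ln (p / q) = p - q \<Longrightarrow> p = q" by auto
qed

lemma gibbs:
  fixes p q :: "'n::finite pmf"
  assumes "\<And>i. 0 < pmf p i \<Longrightarrow> 0 < pmf q i"
  shows "0 \<le> (\<Sum>i\<in>UNIV. pmf p i * ln (pmf p i / pmf q i))"
    and "(\<Sum>i\<in>UNIV. pmf p i * ln (pmf p i / pmf q i)) = 0 \<Longrightarrow> p = q"
proof -
  let ?d = "\<lambda>i. pmf p i * ln (pmf p i / pmf q i) - (pmf p i - pmf q i)"
  have d: "0 \<le> ?d i" for i
    using gibbs_term(1)[of "pmf p i" "pmf q i"] assms[of i] by simp
  have s: "(\<Sum>i\<in>UNIV. ?d i) = (\<Sum>i\<in>UNIV. pmf p i * ln (pmf p i / pmf q i))"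
    by (simp add: sum_subtractf sum_pmf_eq_1)
  show "0 \<le> (\<Sum>i\<in>UNIV. pmf p i * ln (pmf p i / pmf q i))"
    unfolding s[symmetric] by (intro sum_nonneg d)
  assume "(\<Sum>i\<in>UNIV. pmf p i * ln (pmf p i / pmf q i)) = 0"
  hence "(\<Sum>i\<in>UNIV. ?d i) = 0" using s by simp
  hence "?d i = 0" for i
    using d by (subst (asm) sum_nonneg_eq_0_iff) auto
  hence "pmf p i = pmf q i" for i
    using gibbs_term(2)[of "pmf p i" "pmf q i"] assms[of i] by simp
  thus "p = q" by (intro pmf_eqI)
qed

lemma ex_pmf_finite:
  fixes f :: "'n::finite \<Rightarrow> real"
  assumes "\<And>i. 0 \<le> f i" "(\<Sum>i\<in>UNIV. f i) = 1"
  shows "\<exists>p. pmf p = f"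
proof -
  have "(\<integral>\<^sup>+ i. ennreal (f i) \<partial>count_space UNIV) = 1"
    using assms by (simp add: nn_integral_count_space_finite)
  thus ?thesis
    using pmf_embed_pmf[of f] assms(1) by blast
qed

lemma agent_maximizer_logit_at:
  fixes \<mu> :: "'n::finite pmf"
  assumes lam: "0 < lam"
    and max: "is_arg_max (agent_objective lam \<tau> \<mu>) (\<lambda>_. True) \<pi>"
    and j0: "0 < pmf \<mu> j\<^sub>0"
  shows "logit_at lam \<tau> \<mu> \<pi> j\<^sub>0"
proof -
  define b where "b = action_prob \<mu> \<pi>"
  define E where "E i j = exp ((match_payoff i j + \<tau> i) / lam)" for i j
  define Z where "Z j = (\<Sum>k\<in>UNIV. b k * E k j)" for j
  have E: "0 < E i j" for i j by (simp add: E_def)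
  have lnE: "match_payoff i j + \<tau> i = lam * ln (E i j)" for i j
    using lam by (simp add: E_def)
  have ap_nonneg: "0 \<le> action_prob \<mu> \<sigma> i" for \<sigma> i
    by (simp add: action_prob_def sum_nonneg)
  have ap_sum: "(\<Sum>i\<in>UNIV. action_prob \<mu> \<sigma> i) = 1" for \<sigma>
    unfolding action_prob_def
    by (subst sum.swap) (simp add: sum_distrib_left[symmetric] sum_pmf_eq_1)
  have ap_pos: "0 < action_prob \<mu> \<sigma> i" if "0 < pmf \<mu> j" "0 < pmf (\<sigma> j) i" for \<sigma> i j
    unfolding action_prob_def using that by (intro sum_pos2[of _ j]) auto
  have b0: "0 \<le> b i" for i by (simp add: b_def ap_nonneg)
  have b1: "(\<Sum>i\<in>UNIV. b i) = 1" by (simp add: b_def ap_sum)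
  obtain i\<^sub>0 where i0: "0 < b i\<^sub>0"
  proof -
    have "\<not> (\<forall>i. b i = 0)"
    proof
      assume "\<forall>i. b i = 0"
      hence "(\<Sum>i\<in>UNIV. b i) = 0" by simp
      with b1 show False by simp
    qed
    with that b0 show ?thesis by (metis less_eq_real_def)
  qed
  have Z: "0 < Z j" for j
    unfolding Z_def using i0 E b0 less_imp_le[OF E] by (intro sum_pos2[of _ i\<^sub>0]) auto
  have "\<exists>p. pmf p = (\<lambda>i. b i * E i j / Z j)" for j
  proof (rule ex_pmf_finite)
    show "0 \<le> b i * E i j / Z j" for i
      using b0[of i] E[of i j] Z[of j] by simp
    have "(\<Sum>i\<in>UNIV. b i * E i j / Z j) = Z j / Z j"
      unfolding sum_divide_distrib[symmetric] Z_def ..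
    thus "(\<Sum>i\<in>UNIV. b i * E i j / Z j) = 1" using Z[of j] by simp
  qed
  then obtain \<sigma> where \<sigma>: "\<And>j. pmf (\<sigma> j) = (\<lambda>i. b i * E i j / Z j)" by metis
  define c where "c = action_prob \<mu> \<sigma>"
  obtain B where B: "pmf B = b" using ex_pmf_finite[of b] b0 b1 by blast
  obtain C where C: "pmf C = c"
    using ex_pmf_finite[of c] ap_nonneg ap_sum unfolding c_def by blast
  have cb: "0 < b i" if "0 < c i" for i
  proof (rule ccontr)
    assume "\<not> 0 < b i"
    hence "b i = 0" using b0[of i] by simp
    hence "c i = 0" by (simp add: c_def action_prob_def \<sigma>)
    with that show False by simp
  qed
  have \<pi>\<sigma>: "0 < pmf (\<sigma> j) i" if "0 < pmf \<mu> j" "0 < pmf (\<pi> j) i" for i j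
    using ap_pos[of j \<pi> i] that E[of i j] Z[of j] by (simp add: \<sigma> b_def)
  have obj: "agent_objective lam \<tau> \<mu> \<phi> =
     (\<Sum>j\<in>UNIV. \<Sum>i\<in>UNIV. pmf \<mu> j * pmf (\<phi> j) i *
        (lam * ln (E i j) - lam * ln (pmf (\<phi> j) i / action_prob \<mu> \<phi> i)))" for \<phi>
    unfolding agent_objective_def lnE
    by (simp add: sum_distrib_left sum_subtractf[symmetric] algebra_simps)
  let ?KL = "\<lambda>j. \<Sum>i\<in>UNIV. pmf (\<pi> j) i * ln (pmf (\<pi> j) i / pmf (\<sigma> j) i)"
  let ?KC = "\<Sum>i\<in>UNIV. c i * ln (c i / b i)"
  let ?L = "\<Sum>j\<in>UNIV. pmf \<mu> j * ln (Z j)"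
  have J\<pi>: "agent_objective lam \<tau> \<mu> \<pi> = lam * ?L - lam * (\<Sum>j\<in>UNIV. pmf \<mu> j * ?KL j)"
  proof -
    have "agent_objective lam \<tau> \<mu> \<pi> = (\<Sum>j\<in>UNIV. \<Sum>i\<in>UNIV. pmf \<mu> j * pmf (\<pi> j) i *
        (lam * ln (Z j) - lam * ln (pmf (\<pi> j) i / pmf (\<sigma> j) i)))"
      unfolding obj
    proof (intro sum.cong refl)
      fix i j
      show "pmf \<mu> j * pmf (\<pi> j) i * (lam * ln (E i j)
              - lam * ln (pmf (\<pi> j) i / action_prob \<mu> \<pi> i)) =
            pmf \<mu> j * pmf (\<pi> j) i * (lam * ln (Z j)
              - lam * ln (pmf (\<pi> j) i / pmf (\<sigma> j) i))"
      proof (cases "pmf \<mu> j = 0 \<or> pmf (\<pi> j) i = 0")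
        case False
        hence "0 < pmf \<mu> j" "0 < pmf (\<pi> j) i" by (auto simp: order_less_le)
        moreover from this have "0 < b i" unfolding b_def by (rule ap_pos)
        ultimately show ?thesis
          using E[of i j] Z[of j]
          by (simp add: \<sigma> b_def[symmetric] ln_div ln_mult algebra_simps)
      qed auto
    qed
    also have "\<dots> = (\<Sum>j\<in>UNIV. pmf \<mu> j * (lam * ln (Z j) * (\<Sum>i\<in>UNIV. pmf (\<pi> j) i) - lam * ?KL j))"
      by (simp add: sum_distrib_left sum_subtractf[symmetric] algebra_simps)
    also have "\<dots> = lam * ?L - lam * (\<Sum>j\<in>UNIV. pmf \<mu> j * ?KL j)"
      by (simp add: sum_pmf_eq_1 right_diff_distrib sum_subtractf sum_distrib_left mult.left_commute)
    finally show ?thesis .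
  qed
  have J\<sigma>: "agent_objective lam \<tau> \<mu> \<sigma> = lam * ?L + lam * ?KC"
  proof -
    have "agent_objective lam \<tau> \<mu> \<sigma> = (\<Sum>j\<in>UNIV. \<Sum>i\<in>UNIV. pmf \<mu> j * pmf (\<sigma> j) i *
        (lam * ln (Z j) + lam * ln (c i / b i)))"
      unfolding obj
    proof (intro sum.cong refl)
      fix i j
      show "pmf \<mu> j * pmf (\<sigma> j) i * (lam * ln (E i j)
              - lam * ln (pmf (\<sigma> j) i / action_prob \<mu> \<sigma> i)) =
            pmf \<mu> j * pmf (\<sigma> j) i * (lam * ln (Z j) + lam * ln (c i / b i))"
      proof (cases "pmf \<mu> j = 0 \<or> pmf (\<sigma> j) i = 0")
        case False
        hence "0 < pmf \<mu> j" "0 < pmf (\<sigma> j) i" by (auto simp: order_less_le)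
        hence c: "0 < c i" unfolding c_def by (rule ap_pos)
        hence b: "0 < b i" by (rule cb)
        have "lam * ln (E i j) - lam * ln (b i * E i j / Z j / c i) =
              lam * ln (Z j) + lam * ln (c i / b i)"
          using b c E[of i j] Z[of j] by (simp add: ln_div ln_mult algebra_simps)
        thus ?thesis unfolding c_def[symmetric] \<sigma> by simp
      qed auto
    qed
    also have "\<dots> = (\<Sum>j\<in>UNIV. lam * (pmf \<mu> j * ln (Z j)) * (\<Sum>i\<in>UNIV. pmf (\<sigma> j) i))
        + (\<Sum>j\<in>UNIV. \<Sum>i\<in>UNIV. lam * (pmf \<mu> j * pmf (\<sigma> j) i * ln (c i / b i)))"
      by (simp only: sum_distrib_left sum.distrib[symmetric]) (simp add: algebra_simps)
    also have "(\<Sum>j\<in>UNIV. \<Sum>i\<in>UNIV. lam * (pmf \<mu> j * pmf (\<sigma> j) i * ln (c i / b i)))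
        = lam * ?KC"
      by (subst sum.swap)
        (simp add: c_def action_prob_def sum_distrib_left sum_distrib_right mult.assoc)
    finally show ?thesis by (simp add: sum_pmf_eq_1 sum_distrib_left)
  qed
  have KC: "0 \<le> ?KC"
    using gibbs(1)[of C B] cb unfolding B C by blast
  have "agent_objective lam \<tau> \<mu> \<sigma> \<le> agent_objective lam \<tau> \<mu> \<pi>"
    using max unfolding is_arg_max_def by (simp add: not_less)
  hence "lam * (\<Sum>j\<in>UNIV. pmf \<mu> j * ?KL j) \<le> - (lam * ?KC)"
    unfolding J\<pi> J\<sigma> by simp
  also have "\<dots> \<le> 0" using KC lam by simp
  finally have le: "(\<Sum>j\<in>UNIV. pmf \<mu> j * ?KL j) \<le> 0"
    using lam by (simp add: mult_le_0_iff)
  have nn: "0 \<le> pmf \<mu> j * ?KL j" for j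
  proof (cases "pmf \<mu> j = 0")
    case False
    hence "0 < pmf \<mu> j" by (simp add: order_less_le)
    thus ?thesis using gibbs(1)[of "\<pi> j" "\<sigma> j"] \<pi>\<sigma> by simp
  qed simp
  have "(\<Sum>j\<in>UNIV. pmf \<mu> j * ?KL j) = 0"
    using le nn by (intro antisym sum_nonneg) auto
  hence "pmf \<mu> j\<^sub>0 * ?KL j\<^sub>0 = 0"
    using nn by (subst (asm) sum_nonneg_eq_0_iff) auto
  hence "?KL j\<^sub>0 = 0" using j0 by simp
  hence "\<pi> j\<^sub>0 = \<sigma> j\<^sub>0"
    using gibbs(2)[of "\<pi> j\<^sub>0" "\<sigma> j\<^sub>0"] \<pi>\<sigma> j0 by blast
  thus ?thesis
    unfolding logit_at_def by (simp add: \<sigma> b_def Z_def E_def)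
qed

lemma solves_agent_iff:
  assumes "0 < lam"
  shows "solves_agent lam \<tau> \<mu> \<pi> \<longleftrightarrow>
     is_arg_max (agent_objective lam \<tau> \<mu>) (\<lambda>_. True) \<pi> \<and>
     (\<forall>j. pmf \<mu> j = 0 \<longrightarrow> logit_at lam \<tau> \<mu> \<pi> j)"
  unfolding solves_agent_def
  using agent_maximizer_logit_at[OF assms, of \<tau> \<mu> \<pi>] pmf_pos[of \<mu>] by blast

end

theory Submission
  imports Defs
begin

text \<open>
  Write \<open>E i j = exp (match_payoff i j / lam)\<close> and \<open>\<kappa> = exp (1 / lam) - 1\<close>. Normalizing
  \<open>\<beta> i * exp (\<tau> i / lam)\<close> to a probability vector \<open>q\<close> turns the logit formula into
  \<open>\<pi>(i | j) = q i * E i j / (1 + \<kappa> * q j)\<close>, so biases and prior enter the decision rule only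
  through \<open>q\<close>. Conversely, by the first-order conditions such a rule is optimal for \<open>(\<tau>, \<mu>)\<close>
  as soon as \<open>exp (\<tau> i / lam) * (\<Sum>j. \<mu> j * E i j / (1 + \<kappa> * q j))\<close> does not depend on \<open>i\<close>.
  For \<open>\<tau> = 0\<close> this is achieved by the prior \<open>\<mu> j = (1 + \<kappa> * q j) / (N + \<kappa>)\<close>, and for a given
  prior by solving for \<open>\<tau>\<close>.
\<close>

section \<open>Action probabilities and optimality of logit rules\<close>

lemma action_prob_nonneg: "0 \<le> action_prob \<mu> \<pi> i"
  by (simp add: action_prob_def sum_nonneg)

lemma sum_action_prob: "(\<Sum>i\<in>UNIV. action_prob \<mu> \<pi> i) = 1"
  unfolding action_prob_def
  by (subst sum.swap) (simp add: sum_distrib_left[symmetric] sum_pmf_eq_1)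

lemma action_prob_pos:
  assumes "0 < pmf \<mu> j" "0 < pmf (\<pi> j) i"
  shows "0 < action_prob \<mu> \<pi> i"
  unfolding action_prob_def using assms by (intro sum_pos2[of _ j]) auto

text \<open>Some action is chosen with positive probability, since the probabilities sum to one.
  This keeps the logit denominators positive even when other actions are never chosen.\<close>

lemma sum_action_prob_mult_pos:
  fixes \<mu> :: "'n::finite pmf"
  assumes "\<And>k. 0 < f k"
  shows "0 < (\<Sum>k\<in>UNIV. action_prob \<mu> \<pi> k * f k)"
proof -
  have "\<exists>i. action_prob \<mu> \<pi> i \<noteq> 0"
  proof (rule ccontr)
    assume "\<not> ?thesis"
    then have "(\<Sum>i\<in>UNIV. action_prob \<mu> \<pi> i) = 0" by simp
    then show False by (simp add: sum_action_prob)
  qed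
  then obtain i where "0 < action_prob \<mu> \<pi> i"
    using action_prob_nonneg[of \<mu> \<pi>] by (metis less_eq_real_def)
  then show ?thesis
    using assms less_imp_le[OF assms]
    by (intro sum_pos2[of _ i]) (auto simp: action_prob_nonneg)
qed

lemma agent_objective_weights:
  assumes "0 < lam" and "\<And>i j. W i j = exp ((match_payoff i j + \<tau> i) / lam)"
  shows "agent_objective lam \<tau> \<mu> \<phi> =
    (\<Sum>j\<in>UNIV. \<Sum>i\<in>UNIV. pmf \<mu> j * (pmf (\<phi> j) i *
       (lam * ln (W i j) - lam * ln (pmf (\<phi> j) i / action_prob \<mu> \<phi> i))))"
proof -
  have "match_payoff i j + \<tau> i = lam * ln (W i j)" for i j
    using assms by simp
  then show ?thesis
    unfolding agent_objective_def
    by (simp add: sum_distrib_left sum_subtractf[symmetric] algebra_simps)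
qed

text \<open>The Gibbs inequality, applied term by term, bounds the objective of any rule
  \<open>\<phi>\<close> by the value at \<open>\<pi>\<close> plus \<open>lam\<close> times the
  \<open>\<phi>\<close>-average of the expressions in \<open>foc\<close> minus one. By
  \<open>foc\<close> this excess is at most zero.\<close>

lemma solves_agent_if_logit_at:
  fixes \<mu> :: "'n::finite pmf"
  assumes lam: "0 < lam"
    and logit: "\<And>j. logit_at lam \<tau> \<mu> \<pi> j"
    and foc: "\<And>i. (\<Sum>j\<in>UNIV. pmf \<mu> j * exp ((match_payoff i j + \<tau> i) / lam) /
        (\<Sum>k\<in>UNIV. action_prob \<mu> \<pi> k * exp ((match_payoff k j + \<tau> k) / lam))) \<le> 1"
  shows "solves_agent lam \<tau> \<mu> \<pi>"
proof -
  define W where "W i j = exp ((match_payoff i j + \<tau> i) / lam)" for i j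
  define Z where "Z j = (\<Sum>k\<in>UNIV. action_prob \<mu> \<pi> k * W k j)" for j
  have W: "0 < W i j" for i j by (simp add: W_def)
  have Z: "0 < Z j" for j
    unfolding Z_def by (intro sum_action_prob_mult_pos W)
  have \<pi>: "pmf (\<pi> j) i = action_prob \<mu> \<pi> i * W i j / Z j" for i j
    using logit[of j] by (simp add: logit_at_def W_def Z_def)
  have foc': "(\<Sum>j\<in>UNIV. pmf \<mu> j * W i j / Z j) \<le> 1" for i
    using foc[of i] by (simp add: W_def Z_def)
  note obj = agent_objective_weights[OF lam W_def]
  \<comment> \<open>\<open>lam * ln (Z j)\<close> is constant across actions, so its expectation is
    the same for \<open>\<pi>\<close> and for every competitor.\<close>
  have V: "(\<Sum>j\<in>UNIV. \<Sum>i\<in>UNIV. pmf \<mu> j * (pmf (\<phi> j) i * (lam * ln (Z j)))) =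
      (\<Sum>j\<in>UNIV. pmf \<mu> j * (lam * ln (Z j)))" for \<phi> :: "'n \<Rightarrow> 'n pmf"
    by (simp add: sum_distrib_left[symmetric] sum_distrib_right[symmetric] sum_pmf_eq_1)
  have value_\<pi>: "agent_objective lam \<tau> \<mu> \<pi> = (\<Sum>j\<in>UNIV. pmf \<mu> j * (lam * ln (Z j)))"
    unfolding obj V[of \<pi>, symmetric]
  proof (intro sum.cong refl)
    fix i j
    show "pmf \<mu> j * (pmf (\<pi> j) i * (lam * ln (W i j)
            - lam * ln (pmf (\<pi> j) i / action_prob \<mu> \<pi> i))) =
          pmf \<mu> j * (pmf (\<pi> j) i * (lam * ln (Z j)))"
    proof (cases "action_prob \<mu> \<pi> i = 0")
      case True
      then show ?thesis by (simp add: \<pi>)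
    next
      case False
      then have "pmf (\<pi> j) i / action_prob \<mu> \<pi> i = W i j / Z j"
        by (simp add: \<pi>)
      then show ?thesis
        using W[of i j] Z[of j] by (simp add: ln_div algebra_simps)
    qed
  qed
  have "agent_objective lam \<tau> \<mu> \<phi> \<le> agent_objective lam \<tau> \<mu> \<pi>" for \<phi>
  proof -
    define b where "b = action_prob \<mu> \<phi>"
    have "agent_objective lam \<tau> \<mu> \<phi> \<le>
        (\<Sum>j\<in>UNIV. \<Sum>i\<in>UNIV. pmf \<mu> j * (pmf (\<phi> j) i * (lam * ln (Z j)))
          + lam * (b i * (pmf \<mu> j * W i j / Z j) - pmf \<mu> j * pmf (\<phi> j) i))"
      unfolding obj
    proof (intro sum_mono)
      fix i j
      show "pmf \<mu> j * (pmf (\<phi> j) i * (lam * ln (W i j)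
            - lam * ln (pmf (\<phi> j) i / action_prob \<mu> \<phi> i))) \<le>
          pmf \<mu> j * (pmf (\<phi> j) i * (lam * ln (Z j)))
          + lam * (b i * (pmf \<mu> j * W i j / Z j) - pmf \<mu> j * pmf (\<phi> j) i)"
      proof (cases "pmf \<mu> j = 0 \<or> pmf (\<phi> j) i = 0")
        case True
        have "0 \<le> lam * (b i * (pmf \<mu> j * W i j / Z j))"
          using lam W[of i j] Z[of j] action_prob_nonneg[of \<mu> \<phi> i] by (simp add: b_def)
        with True show ?thesis by auto
      next
        case False
        then have pos: "0 < pmf \<mu> j" "0 < pmf (\<phi> j) i" by (auto simp: order_less_le)
        then have b: "0 < b i" unfolding b_def by (rule action_prob_pos)
        \<comment> \<open>\<open>b\<close> comes from \<open>\<phi>\<close> but \<open>Z\<close>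
          from \<open>\<pi>\<close>, so \<open>?q\<close> need not sum to one over the actions;
          hence the termwise inequality, whose defect \<open>?q - ?p\<close> is carried
          along.\<close>
        let ?p = "pmf (\<phi> j) i" and ?q = "b i * W i j / Z j"
        have "ln (?p / ?q) = ln (?p / b i) - ln (W i j) + ln (Z j)"
          using pos b W[of i j] Z[of j] by (simp add: ln_div ln_mult)
        moreover have "?p - ?q \<le> ?p * ln (?p / ?q)"
          using pos b W[of i j] Z[of j] by (intro gibbs_term(1)) auto
        ultimately have "?p - ?q \<le> ?p * (ln (?p / b i) - ln (W i j) + ln (Z j))"
          by metis
        then have "?p * (ln (W i j) - ln (?p / b i)) \<le> ?p * ln (Z j) + (?q - ?p)"
          by (simp add: algebra_simps)
        then have "lam * pmf \<mu> j * (?p * (ln (W i j) - ln (?p / b i)))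
            \<le> lam * pmf \<mu> j * (?p * ln (Z j) + (?q - ?p))"
          using lam pos by (intro mult_left_mono) auto
        then show ?thesis
          unfolding b_def[symmetric] by (simp add: algebra_simps)
      qed
    qed
    also have "\<dots> = agent_objective lam \<tau> \<mu> \<pi> +
        lam * ((\<Sum>i\<in>UNIV. b i * (\<Sum>j\<in>UNIV. pmf \<mu> j * W i j / Z j)) - 1)"
    proof -
      have "(\<Sum>j\<in>UNIV. \<Sum>i\<in>UNIV. b i * (pmf \<mu> j * W i j / Z j)) =
          (\<Sum>i\<in>UNIV. b i * (\<Sum>j\<in>UNIV. pmf \<mu> j * W i j / Z j))"
        by (subst sum.swap) (simp add: sum_distrib_left)
      moreover have "(\<Sum>j\<in>UNIV. \<Sum>i\<in>UNIV. pmf \<mu> j * pmf (\<phi> j) i) = 1"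
        by (simp add: sum_distrib_left[symmetric] sum_pmf_eq_1)
      ultimately show ?thesis
        unfolding value_\<pi> V[of \<phi>, symmetric]
        by (simp only: sum.distrib sum_distrib_left[symmetric] sum_subtractf)
    qed
    also have "\<dots> \<le> agent_objective lam \<tau> \<mu> \<pi>"
    proof -
      have "(\<Sum>i\<in>UNIV. b i * (\<Sum>j\<in>UNIV. pmf \<mu> j * W i j / Z j)) \<le> (\<Sum>i\<in>UNIV. b i * 1)"
        by (intro sum_mono mult_left_mono foc') (simp add: b_def action_prob_nonneg)
      also have "\<dots> = 1" by (simp add: b_def sum_action_prob)
      finally show ?thesis
        using lam by (simp add: mult_le_0_iff)
    qed
    finally show ?thesis .
  qed
  then show ?thesis
    unfolding solves_agent_def is_arg_max_def using logit by (auto simp: not_less)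
qed

section \<open>Decision rules in normalized form\<close>

definition match_denom :: "real \<Rightarrow> 'n pmf \<Rightarrow> 'n \<Rightarrow> real" where
  "match_denom lam q j = 1 + (exp (1 / lam) - 1) * pmf q j"

definition match_logit :: "real \<Rightarrow> 'n pmf \<Rightarrow> ('n \<Rightarrow> 'n pmf) \<Rightarrow> bool" where
  "match_logit lam q \<pi> \<longleftrightarrow>
     (\<forall>i j. pmf (\<pi> j) i = pmf q i * exp (match_payoff i j / lam) / match_denom lam q j)"

text \<open>The left side of the first-order condition of action \<open>i\<close>, up to the payment
  factor and a common scale; it is also the ratio of the action probability to
  \<open>pmf q i\<close> where the latter is nonzero.\<close>

definition match_score :: "real \<Rightarrow> ('n::finite) pmf \<Rightarrow> 'n pmf \<Rightarrow> 'n \<Rightarrow> real" where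
  "match_score lam \<mu> q i =
     (\<Sum>j\<in>UNIV. pmf \<mu> j * (exp (match_payoff i j / lam) / match_denom lam q j))"

text \<open>Splitting off the diagonal lets sums over states or actions collapse to a constant plus
  a single term.\<close>

lemma exp_match_payoff:
  "exp (match_payoff i j / lam) = 1 + (if i = j then exp (1 / lam) - 1 else 0)"
  by (simp add: match_payoff_def)

lemma match_denom_ge_1: "0 < lam \<Longrightarrow> 1 \<le> match_denom lam q j"
  by (simp add: match_denom_def)

lemma sum_exp_match_payoff:
  "(\<Sum>i\<in>UNIV. pmf q i * exp (match_payoff i j / lam)) = match_denom lam q j"
  for q :: "'n::finite pmf"
  unfolding exp_match_payoff match_denom_def distrib_left sum.distrib
  by (simp add: sum_pmf_eq_1 if_distrib[of "(*) _"] mult.commute cong: if_cong)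

lemma action_prob_match_logit:
  "match_logit lam q \<pi> \<Longrightarrow> action_prob \<mu> \<pi> i = pmf q i * match_score lam \<mu> q i"
  by (simp add: match_logit_def action_prob_def match_score_def sum_distrib_left algebra_simps)

text \<open>The constant score makes the logit weights \<open>S\<close> times those of
  \<open>q\<close>. The factor \<open>S\<close> cancels in the logit formula, and the first-order
  conditions hold with equality, also for actions of probability zero.\<close>

lemma solves_agent_if_match_logit:
  assumes lam: "0 < lam"
    and \<pi>: "match_logit lam q \<pi>"
    and score: "\<And>i. exp (\<tau> i / lam) * match_score lam \<mu> q i = S"
    and S: "0 < S"
  shows "solves_agent lam \<tau> \<mu> \<pi>"
proof -
  have weight: "action_prob \<mu> \<pi> i * exp ((match_payoff i j + \<tau> i) / lam) =
      S * (pmf q i * exp (match_payoff i j / lam))" for i j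
    by (simp add: action_prob_match_logit[OF \<pi>] score[of i, symmetric] add_divide_distrib exp_add)
  have total: "(\<Sum>k\<in>UNIV. action_prob \<mu> \<pi> k * exp ((match_payoff k j + \<tau> k) / lam)) =
      S * match_denom lam q j" for j
    unfolding weight sum_distrib_left[symmetric] sum_exp_match_payoff ..
  show ?thesis
  proof (rule solves_agent_if_logit_at[OF lam])
    show "logit_at lam \<tau> \<mu> \<pi> j" for j
      unfolding logit_at_def total unfolding weight using \<pi> S by (simp add: match_logit_def)
    show "(\<Sum>j\<in>UNIV. pmf \<mu> j * exp ((match_payoff i j + \<tau> i) / lam) /
        (\<Sum>k\<in>UNIV. action_prob \<mu> \<pi> k * exp ((match_payoff k j + \<tau> k) / lam))) \<le> 1" for i
    proof -
      have "(\<Sum>j\<in>UNIV. pmf \<mu> j * exp ((match_payoff i j + \<tau> i) / lam) / (S * match_denom lam q j))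
          = exp (\<tau> i / lam) * match_score lam \<mu> q i / S"
        unfolding match_score_def sum_distrib_left sum_divide_distrib
        by (intro sum.cong refl) (simp add: add_divide_distrib exp_add mult_ac)
      then show ?thesis
        unfolding total score using S by simp
    qed
  qed
qed

text \<open>The exponential of payoff plus payment is a product, so the payment factor can be
  absorbed into the action weights; the normalizing constant cancels from the logit
  quotient.\<close>

lemma match_logit_if_solves_agent:
  assumes "solves_agent lam \<tau> \<mu> \<pi>"
  shows "\<exists>q. match_logit lam q \<pi>"
proof -
  define S where "S = (\<Sum>k\<in>UNIV. action_prob \<mu> \<pi> k * exp (\<tau> k / lam))"
  have S: "0 < S"
    unfolding S_def by (intro sum_action_prob_mult_pos) simp
  have "\<exists>q. pmf q = (\<lambda>i. action_prob \<mu> \<pi> i * exp (\<tau> i / lam) / S)"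
  proof (rule ex_pmf_finite)
    show "(\<Sum>i\<in>UNIV. action_prob \<mu> \<pi> i * exp (\<tau> i / lam) / S) = 1"
      unfolding sum_divide_distrib[symmetric] S_def[symmetric] using S by simp
  qed (use S in \<open>simp add: action_prob_nonneg\<close>)
  then obtain q where q: "pmf q = (\<lambda>i. action_prob \<mu> \<pi> i * exp (\<tau> i / lam) / S)" ..
  have weight: "action_prob \<mu> \<pi> i * exp ((match_payoff i j + \<tau> i) / lam) =
      S * (pmf q i * exp (match_payoff i j / lam))" for i j
    using S by (simp add: q add_divide_distrib exp_add)
  have "(\<Sum>k\<in>UNIV. action_prob \<mu> \<pi> k * exp ((match_payoff k j + \<tau> k) / lam)) =
      S * match_denom lam q j" for j
    unfolding weight sum_distrib_left[symmetric] sum_exp_match_payoff ..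
  then have "match_logit lam q \<pi>"
    using assms S unfolding solves_agent_def logit_at_def match_logit_def weight by simp
  then show ?thesis ..
qed

section \<open>Priors and payments supporting a given rule\<close>

lemma ex_prior_match_logit:
  fixes q :: "'n::finite pmf"
  assumes lam: "0 < lam" and \<pi>: "match_logit lam q \<pi>"
  shows "\<exists>\<mu>. solves_agent lam (\<lambda>_. 0) \<mu> \<pi>"
proof -
  \<comment> \<open>\<open>T\<close> plays two roles: it is the total of \<open>match_denom\<close>,
    hence normalizes the prior, and it is the sum of \<open>exp (match_payoff i j / lam)\<close>
    over \<open>j\<close> for every \<open>i\<close>. Thus all scores equal one.\<close>
  define T where "T = real CARD('n) + (exp (1 / lam) - 1)"
  have T: "0 < T"
    using lam by (simp add: T_def add_pos_pos)
  have D: "0 < match_denom lam q j" for j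
    using match_denom_ge_1[OF lam, of q j] by simp
  have "\<exists>\<mu>. pmf \<mu> = (\<lambda>j. match_denom lam q j / T)"
  proof (rule ex_pmf_finite)
    show "0 \<le> match_denom lam q j / T" for j
      using D[of j] T by simp
    have "(\<Sum>j\<in>UNIV. match_denom lam q j) = T"
      by (simp add: match_denom_def T_def sum.distrib sum_distrib_left[symmetric] sum_pmf_eq_1)
    then show "(\<Sum>j\<in>UNIV. match_denom lam q j / T) = 1"
      using T by (simp add: sum_divide_distrib[symmetric])
  qed
  then obtain \<mu> where \<mu>: "pmf \<mu> = (\<lambda>j. match_denom lam q j / T)" ..
  have "match_score lam \<mu> q i = 1" for i
  proof -
    have "match_score lam \<mu> q i = (\<Sum>j\<in>UNIV. exp (match_payoff i j / lam) / T)"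
      unfolding match_score_def \<mu> using D T
      by (intro sum.cong refl) (simp add: less_imp_neq[symmetric])
    also have "\<dots> = (\<Sum>j\<in>UNIV. exp (match_payoff i j / lam)) / T"
      by (simp add: sum_divide_distrib)
    also have "(\<Sum>j\<in>UNIV. exp (match_payoff i j / lam)) = T"
      unfolding exp_match_payoff T_def by (simp add: sum.distrib)
    finally show ?thesis using T by simp
  qed
  then have "solves_agent lam (\<lambda>_. 0) \<mu> \<pi>"
    by (intro solves_agent_if_match_logit[OF lam \<pi>, where S = 1]) simp_all
  then show ?thesis ..
qed

lemma match_score_pos:
  assumes "0 < lam"
  shows "0 < match_score lam \<mu> q i"
proof -
  have "0 < match_denom lam q j" for j
    using match_denom_ge_1[OF assms, of q j] by simp
  moreover obtain j where "j \<in> set_pmf \<mu>"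
    using set_pmf_not_empty[of \<mu>] by blast
  ultimately show ?thesis
    unfolding match_score_def
    by (intro sum_pos2[of _ j]) (auto simp: pmf_positive less_imp_le)
qed

text \<open>A score is a \<open>\<mu>\<close>-average of ratios with numerator at most
  \<open>exp (1 / lam)\<close> and denominator at least one. The bound is what makes the payments
  below nonnegative.\<close>

lemma match_score_le:
  assumes "0 < lam"
  shows "match_score lam \<mu> q i \<le> exp (1 / lam)"
proof -
  have "exp (match_payoff i j / lam) / match_denom lam q j \<le> exp (1 / lam)" for j
  proof -
    have "exp (match_payoff i j / lam) / match_denom lam q j \<le> exp (match_payoff i j / lam) / 1"
      using match_denom_ge_1[OF assms, of q j] by (intro divide_left_mono) auto
    also have "\<dots> \<le> exp (1 / lam)"
      using assms by (simp add: match_payoff_def)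
    finally show ?thesis .
  qed
  then have "match_score lam \<mu> q i \<le> (\<Sum>j\<in>UNIV. pmf \<mu> j * exp (1 / lam))"
    unfolding match_score_def by (intro sum_mono mult_left_mono) auto
  also have "\<dots> = exp (1 / lam)"
    by (simp add: sum_distrib_right[symmetric] sum_pmf_eq_1)
  finally show ?thesis .
qed

lemma ex_payments_match_logit:
  assumes lam: "0 < lam" and \<pi>: "match_logit lam q \<pi>"
  shows "\<exists>\<tau>. (\<forall>i. 0 \<le> \<tau> i) \<and> solves_agent lam \<tau> \<mu> \<pi>"
proof (intro exI conjI allI)
  \<comment> \<open>Solving \<open>exp (\<tau> i / lam) * match_score lam \<mu> q i = S\<close> for
    \<open>\<tau> i\<close> leaves \<open>S\<close> free, a common shift of all payments. Taking
    \<open>S\<close> as the upper bound \<open>exp (1 / lam)\<close> of the scores gives the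
    constant 1 and nonnegative payments.\<close>
  let ?\<tau> = "\<lambda>i. 1 - lam * ln (match_score lam \<mu> q i)"
  note pos = match_score_pos[OF lam, of \<mu> q]
  show "0 \<le> ?\<tau> i" for i
  proof -
    have "ln (match_score lam \<mu> q i) \<le> 1 / lam"
      using match_score_le[OF lam, of \<mu> q i] pos[of i] by (metis ln_exp ln_le_cancel_iff exp_gt_zero)
    then show ?thesis
      using lam by (simp add: field_simps)
  qed
  show "solves_agent lam ?\<tau> \<mu> \<pi>"
  proof (rule solves_agent_if_match_logit[OF lam \<pi>])
    show "exp (?\<tau> i / lam) * match_score lam \<mu> q i = exp (1 / lam)" for i
      using lam pos[of i] by (simp add: diff_divide_distrib exp_diff)
  qed simp
qed

section \<open>Equivalence of the two maximization problems\<close>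

lemma ex_is_arg_max_snd_iff:
  "(\<exists>a. is_arg_max (\<lambda>(x, y). f y) (\<lambda>x. x \<in> A) (a, y)) \<longleftrightarrow>
     y \<in> snd ` A \<and> (\<forall>z\<in>snd ` A. \<not> f y < f z)"
  \<comment> \<open>The objective ignores the first component, so only the projection of
    \<open>A\<close> matters and any point over \<open>y\<close> serves as witness.\<close>
  unfolding is_arg_max_def by force

theorem theorem2:
  fixes \<mu>\<^sub>p :: "'n::finite pmf" and lam :: real
  assumes "2 < CARD('n)" and "0 < lam"
  shows
    "(\<forall>\<tau> \<pi>. (\<forall>i. 0 \<le> \<tau> i) \<and> solves_agent lam \<tau> \<mu>\<^sub>p \<pi> \<longrightarrow>
        (\<exists>\<mu>. solves_agent lam (\<lambda>_. 0) \<mu> \<pi>)) \<and>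
     (\<forall>\<mu> \<pi>. solves_agent lam (\<lambda>_. 0) \<mu> \<pi> \<longrightarrow>
        (\<exists>\<tau>. (\<forall>i. 0 \<le> \<tau> i) \<and> solves_agent lam \<tau> \<mu>\<^sub>p \<pi>)) \<and>
     snd ` contracting_feasible lam \<mu>\<^sub>p = snd ` delegation_feasible lam \<and>
     (\<forall>\<tau> \<pi>. contracting_objective 0 \<mu>\<^sub>p \<tau> \<pi> = delegation_objective \<mu>\<^sub>p \<pi>) \<and>
     (\<forall>\<pi>. (\<exists>\<tau>. solves_contracting lam 0 \<mu>\<^sub>p \<mu>\<^sub>p \<tau> \<pi>) \<longleftrightarrow>
           (\<exists>\<mu>. solves_delegation lam \<mu>\<^sub>p \<mu> \<pi>))"
proof -
  note lam = \<open>0 < lam\<close>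
  have prior: "\<exists>\<mu>. solves_agent lam (\<lambda>_. 0) \<mu> \<pi>"
    if "solves_agent lam \<tau> \<mu>\<^sub>p \<pi>" for \<tau> \<pi>
    using match_logit_if_solves_agent[OF that] ex_prior_match_logit[OF lam] by blast
  have payments: "\<exists>\<tau>. (\<forall>i. 0 \<le> \<tau> i) \<and> solves_agent lam \<tau> \<mu>\<^sub>p \<pi>"
    if "solves_agent lam (\<lambda>_. 0) \<mu> \<pi>" for \<mu> \<pi>
    using match_logit_if_solves_agent[OF that] ex_payments_match_logit[OF lam] by blast
  have implementable: "snd ` contracting_feasible lam \<mu>\<^sub>p = snd ` delegation_feasible lam"
    unfolding contracting_feasible_def delegation_feasible_def
    using prior payments by (force simp: image_iff)
  have objective: "contracting_objective 0 \<mu>\<^sub>p \<tau> \<pi> = delegation_objective \<mu>\<^sub>p \<pi>" for \<tau> \<pi>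
    by (simp add: contracting_objective_def delegation_objective_def)
  \<comment> \<open>For \<open>\<rho> = 0\<close> both objectives are the same function of
    \<open>\<pi>\<close>, so the problems differ only in their feasible sets, whose projections
    agree.\<close>
  have "(\<exists>\<tau>. solves_contracting lam 0 \<mu>\<^sub>p \<mu>\<^sub>p \<tau> \<pi>) \<longleftrightarrow> (\<exists>\<mu>. solves_delegation lam \<mu>\<^sub>p \<mu> \<pi>)" for \<pi>
    unfolding solves_contracting_def solves_delegation_def objective
    by (simp only: ex_is_arg_max_snd_iff implementable)
  with prior payments implementable objective show ?thesis
    by blast
qed

end
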